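(* Let $L_0>0$, $L_1\ge0$, $M\ge0$, $\ell(s)=L_0+L_1s^2e^s$, and let $f:\mathbb{R}^d\to\mathbb{R}\cup\{\infty\}$ be $\ell$-smooth, with $f(x)\ge f^*$ and $\|\nabla f(x)\|\le M$ for all $x\in\mathcal{X}$, for some $f^*\in\mathbb{R}$. Let $x_0\in\mathcal{X}$, $\Delta:=f(x_0)-f^*$, and let $\{x_k\}_{k\ge0}$ be generated by $$x_{k+1}=x_k-\gamma_k\nabla f(x_k),\qquad \gamma_k=\int_0^1\frac{dv}{\ell(\|\nabla f(x_k)\|+\|\nabla f(x_k)\|v)}.$$ Then for every $\varepsilon>0$ and every integer $T\ge1$ with $$T\ge\max\left\{\frac{8L_0\Delta}{\varepsilon},\,32L_1\Delta e^{2M}\right\}$$ one has $\min_{k\in\{0,\dots,T-1\}}\|\nabla f(x_k)\|^2\le\varepsilon$.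
   Context: Norms are Euclidean for vectors and spectral for matrices. For $f:\mathbb{R}^d\to\mathbb{R}\cup\{\infty\}$ put $\mathcal{X}=\{x\in\mathbb{R}^d: f(x)<\infty\}$, assumed to be open and convex. $f$ is $\ell$-smooth if $f$ is twice differentiable on $\mathcal{X}$, continuous on the closure of $\mathcal{X}$ (as a map into $\mathbb{R}\cup\{\infty\}$), and $\|\nabla^2f(x)\|\le\ell(\|\nabla f(x)\|)$ for all $x\in\mathcal{X}$. (The iteration is well defined: the iterates stay in $\mathcal{X}$.) *)

theory Defs
  imports "HOL-Analysis.Analysis"
begin

text \<open>
  A function with values in the reals extended by infinity is an \<open>ereal\<close>-valued function that
  avoids \<open>-\<infinity>\<close>; the latter is an explicit hypothesis wherever it is needed.
\<close>

definition effective_domain :: "('a \<Rightarrow> ereal) \<Rightarrow> 'a set"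
  where "effective_domain f = {x. f x < \<infinity>}"

text \<open>
  On an open effective domain, \<open>\<lambda>y. real_of_ereal (f y)\<close> agrees with \<open>f\<close> near each point, so the
  arbitrary value that \<open>real_of_ereal\<close> takes at \<open>\<infinity>\<close> does not affect derivatives there.
  Outside the domain the gradient and the Hessian below carry no meaning.
\<close>

definition gradient :: "(real ^ 'n \<Rightarrow> ereal) \<Rightarrow> real ^ 'n \<Rightarrow> real ^ 'n"
  where "gradient f x = (THE D. GDERIV (\<lambda>y. real_of_ereal (f y)) x :> D)"

definition hessian :: "(real ^ 'n \<Rightarrow> ereal) \<Rightarrow> real ^ 'n \<Rightarrow> real ^ 'n ^ 'n"
  where "hessian f x = jacobian (gradient f) (at x)"

definition spectral_norm :: "real ^ 'n ^ 'n \<Rightarrow> real"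
  where "spectral_norm A = onorm (\<lambda>v. A *v v)"

definition twice_differentiable_on_domain :: "(real ^ 'n \<Rightarrow> ereal) \<Rightarrow> bool"
  where "twice_differentiable_on_domain f \<longleftrightarrow>
    (\<forall>x\<in>effective_domain f.
      (\<lambda>y. real_of_ereal (f y)) differentiable (at x) \<and> gradient f differentiable (at x))"

definition ell_smooth :: "(real \<Rightarrow> real) \<Rightarrow> (real ^ 'n \<Rightarrow> ereal) \<Rightarrow> bool"
  where "ell_smooth ell f \<longleftrightarrow>
    twice_differentiable_on_domain f \<and>
    continuous_on (closure (effective_domain f)) f \<and>
    (\<forall>x\<in>effective_domain f. spectral_norm (hessian f x) \<le> ell (norm (gradient f x)))"

end

theory Submission
  imports Defs
begin

text \<open>
  Each step decreases \<open>f\<close> by at least \<open>\<gamma>\<^sub>k g\<^sub>k\<^sup>2 / 2\<close>, where \<open>g\<^sub>k\<close> is the norm of the gradient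
  at \<open>x\<^sub>k\<close>; the particular step size is what makes this work.  Along the step
  \<open>t \<mapsto> x\<^sub>k - t \<gamma>\<^sub>k \<nabla>f(x\<^sub>k)\<close>, the Hessian bound makes the gradient difference
  \<open>h(t) = \<parallel>\<nabla>f(x(t)) - \<nabla>f(x\<^sub>k)\<parallel>\<close> satisfy \<open>h' \<le> \<gamma>\<^sub>k g\<^sub>k \<ell>(g\<^sub>k + h)\<close>.  Separation of variables
  bounds \<open>q(h(t))\<close> by \<open>t \<gamma>\<^sub>k g\<^sub>k\<close>, where \<open>q(w)\<close> is the integral of \<open>1/\<ell>(g\<^sub>k + v)\<close> over \<open>[0, w]\<close>.
  Substitution in the integral defining \<open>\<gamma>\<^sub>k\<close> gives \<open>q(g\<^sub>k) = \<gamma>\<^sub>k g\<^sub>k\<close>, so \<open>h\<close> does not exceed \<open>g\<^sub>k\<close>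
  before the step is complete, and since \<open>\<ell>\<close> is nondecreasing, \<open>q\<close> is concave, which sharpens the
  bound to \<open>h(t) \<le> t g\<^sub>k\<close> (\<open>growth_comparison\<close>).  Hence the slope of \<open>f\<close> along the step is at most
  \<open>-\<gamma>\<^sub>k g\<^sub>k\<^sup>2 (1 - t)\<close>, and integrating it gives the decrease (\<open>descent_within_domain\<close>).

  All this presupposes that the step stays in the effective domain.  It does, because \<open>f\<close> cannot
  increase as long as the step has not left the domain, whereas by continuity into the extended
  reals \<open>f\<close> is infinite at a boundary point (\<open>gradient_step_in_domain\<close>).

  By monotonicity of \<open>\<ell>\<close>, \<open>\<gamma>\<^sub>k\<close> is at least \<open>1/\<ell>(2 g\<^sub>k)\<close>.  If \<open>g\<^sub>k\<^sup>2 > \<epsilon>\<close> for all \<open>k < T\<close>, the bound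
  \<open>g\<^sub>k \<le> M\<close> in the exponential turns this into a decrease of more than
  \<open>\<epsilon> / (4 (L\<^sub>0 + 4 L\<^sub>1 \<epsilon> e\<^sup>2\<^sup>M))\<close> per step, and \<open>T\<close> of these exceed \<open>\<Delta>\<close>: the maximum that bounds \<open>T\<close>
  from below dominates the average of its two arguments.
\<close>

section \<open>A differential inequality for the gradient difference\<close>

text \<open>
  This is the comparison argument for \<open>h' \<le> \<gamma> g \<ell>(g + h)\<close> with \<open>h = \<parallel>G\<parallel>\<close>, started at \<open>h = 0\<close>.
  The derivative of \<open>G\<close> need not be continuous, so the inequality is not turned into an integral one;
  instead a primitive of \<open>1/\<ell>(g + v)\<close> is composed with \<open>h\<close> and the sign of the derivative is used.
  Because the norm is not differentiable at \<open>0\<close>, this is done for \<open>\<surd>(\<parallel>G\<parallel>\<^sup>2 + \<delta>)\<close> first.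
\<close>

lemma growth_comparison:
  fixes G G' :: "real \<Rightarrow> 'a::real_inner" and ell :: "real \<Rightarrow> real"
  assumes cont: "continuous_on {0..} ell"
    and pos: "\<And>s. 0 \<le> s \<Longrightarrow> 0 < ell s"
    and mono: "\<And>s t. 0 \<le> s \<Longrightarrow> s \<le> t \<Longrightarrow> ell s \<le> ell t"
    and g: "0 \<le> g" and \<tau>: "0 \<le> \<tau>" "\<tau> \<le> 1"
    and \<gamma>: "\<gamma> = integral {0..1} (\<lambda>v. 1 / ell (g + g * v))" and \<gamma>_pos: "0 < \<gamma>"
    and G0: "G 0 = 0"
    and deriv: "\<And>t. t \<in> {0..\<tau>} \<Longrightarrow> (G has_vector_derivative G' t) (at t)"
    and growth: "\<And>t. t \<in> {0..\<tau>} \<Longrightarrow> norm (G' t) \<le> \<gamma> * g * ell (g + norm (G t))"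
  shows "norm (G \<tau>) \<le> \<tau> * g"
proof -
  \<comment> \<open>The absolute value makes the integrand continuous on the whole line, so that its primitive
    is differentiable at \<open>0\<close> from both sides.\<close>
  define k where "k v = 1 / ell (g + \<bar>v\<bar>)" for v
  have k_cont: "continuous_on UNIV k"
    unfolding k_def
  proof (intro continuous_intros ballI)
    show "continuous_on UNIV (\<lambda>v. ell (g + \<bar>v\<bar>))"
      by (rule continuous_on_compose2[OF cont]) (use g in \<open>auto intro!: continuous_intros\<close>)
    show "ell (g + \<bar>v\<bar>) \<noteq> 0" for v
      using pos[of "g + \<bar>v\<bar>"] g by auto
  qed
  have k_pos: "0 < k v" for v
    using pos[of "g + \<bar>v\<bar>"] g by (auto simp: k_def)
  have "\<exists>Q. \<forall>v. -\<infinity> < ereal v \<longrightarrow> ereal v < \<infinity> \<longrightarrow> (Q has_vector_derivative k v) (at v)"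
    by (rule einterval_antiderivative)
       (use k_cont in \<open>auto simp: continuous_on_eq_continuous_within\<close>)
  then obtain Q where Q: "(Q has_real_derivative k v) (at v)" for v
    by (auto simp: has_real_derivative_iff_has_vector_derivative)
  have Q_strict: "Q a < Q b" if "a < b" for a b
    using DERIV_pos_imp_increasing[OF that] Q k_pos by blast
  have Q_isCont: "isCont Q v" for v
    using Q DERIV_isCont by blast
  have Q_scaled: "((\<lambda>v. w * k (w * v)) has_integral (Q w - Q 0)) {0..1}" for w
  proof -
    have "((\<lambda>v. w * k (w * v)) has_integral (Q (w * 1) - Q (w * 0))) {0..1}"
    proof (rule fundamental_theorem_of_calculus)
      fix v :: real
      have "((\<lambda>v. Q (w * v)) has_real_derivative k (w * v) * w) (at v within {0..1})"
        by (rule DERIV_chain2[OF Q]) (auto intro!: derivative_eq_intros)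
      then show "((\<lambda>v. Q (w * v)) has_vector_derivative w * k (w * v)) (at v within {0..1})"
        by (simp add: has_real_derivative_iff_has_vector_derivative mult.commute)
    qed simp
    then show ?thesis by simp
  qed
  have k_scaled_int: "(\<lambda>v. k (w * v)) integrable_on {0..1}" for w
    by (intro integrable_continuous_real continuous_on_compose2[OF k_cont])
       (auto intro!: continuous_intros)
  have \<gamma>_k: "\<gamma> = integral {0..1} (\<lambda>v. k (g * v))"
    unfolding \<gamma> by (rule integral_cong) (use g in \<open>simp add: k_def\<close>)
  have Q_concave: "w * \<gamma> \<le> Q w - Q 0" if "0 \<le> w" "w \<le> g" for w
  proof -
    have "w * \<gamma> = integral {0..1} (\<lambda>v. w * k (g * v))"
      by (simp add: \<gamma>_k)
    also have "\<dots> \<le> integral {0..1} (\<lambda>v. w * k (w * v))"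
    proof (rule integral_le)
      show "(\<lambda>v. w * k (g * v)) integrable_on {0..1}" "(\<lambda>v. w * k (w * v)) integrable_on {0..1}"
        using k_scaled_int by (auto intro: integrable_on_mult_right)
      fix v :: real assume v: "v \<in> {0..1}"
      have "w * v \<le> g * v"
        using v that by (auto intro: mult_right_mono)
      then have "ell (g + w * v) \<le> ell (g + g * v)"
        using v that g by (intro mono) auto
      then have "k (g * v) \<le> k (w * v)"
        using v that g pos[of "g + w * v"] by (auto simp: k_def intro!: divide_left_mono mult_pos_pos pos)
      then show "w * k (g * v) \<le> w * k (w * v)"
        using that by (intro mult_left_mono)
    qed
    also have "\<dots> = Q w - Q 0"
      using Q_scaled by (rule integral_unique)
    finally show ?thesis .
  qed
  have Q_g: "Q g - Q 0 = \<gamma> * g"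
    using integral_unique[OF Q_scaled[of g]] by (simp add: \<gamma>_k mult.commute)
  have Q_smoothed: "Q (sqrt (G \<tau> \<bullet> G \<tau> + \<delta>)) \<le> Q (sqrt \<delta>) + \<gamma> * g * \<tau>" if \<delta>: "0 < \<delta>" for \<delta>
  proof -
    define n where "n t = sqrt (G t \<bullet> G t + \<delta>)" for t
    have n_pos: "0 < n t" for t
      unfolding n_def using \<delta> by (simp add: add_nonneg_pos)
    have n_ge: "norm (G t) \<le> n t" for t
      unfolding n_def using \<delta> by (simp add: norm_eq_sqrt_inner)
    have "Q (n \<tau>) - \<gamma> * g * \<tau> \<le> Q (n 0) - \<gamma> * g * 0"
    proof (rule DERIV_nonpos_imp_nonincreasing[OF \<tau>(1), of "\<lambda>t. Q (n t) - \<gamma> * g * t"])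
      fix t assume "0 \<le> t" "t \<le> \<tau>"
      then have t: "t \<in> {0..\<tau>}" by simp
      have "((\<lambda>t. G t \<bullet> G t + \<delta>) has_real_derivative 2 * (G t \<bullet> G' t)) (at t)"
        using deriv[OF t] unfolding has_vector_derivative_def has_field_derivative_def
        by (auto intro!: derivative_eq_intros simp: inner_commute algebra_simps fun_eq_iff)
      moreover have "0 < G t \<bullet> G t + \<delta>"
        using \<delta> by (simp add: add_nonneg_pos)
      ultimately have "((\<lambda>t. sqrt (G t \<bullet> G t + \<delta>)) has_real_derivative
          inverse (sqrt (G t \<bullet> G t + \<delta>)) / 2 * (2 * (G t \<bullet> G' t))) (at t)"
        by (rule DERIV_chain2[OF DERIV_real_sqrt, where g = "\<lambda>t. G t \<bullet> G t + \<delta>", rotated])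
      then have "(n has_real_derivative (G t \<bullet> G' t) / n t) (at t)"
        unfolding n_def by (simp add: field_simps)
      then have D: "((\<lambda>t. Q (n t) - \<gamma> * g * t) has_real_derivative
          k (n t) * ((G t \<bullet> G' t) / n t) - \<gamma> * g) (at t)"
        by (auto intro!: derivative_eq_intros DERIV_chain2[OF Q])
      have "G t \<bullet> G' t \<le> norm (G t) * norm (G' t)"
        by (rule norm_cauchy_schwarz)
      also have "\<dots> \<le> n t * norm (G' t)"
        by (intro mult_right_mono n_ge) simp
      finally have "(G t \<bullet> G' t) / n t \<le> norm (G' t)"
        using n_pos[of t] by (simp add: field_simps)
      also have "\<dots> \<le> \<gamma> * g * ell (g + norm (G t))"
        by (rule growth[OF t])
      also have "\<dots> \<le> \<gamma> * g * ell (g + n t)"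
        using g \<gamma>_pos n_ge[of t] by (intro mult_left_mono mono) auto
      finally have "k (n t) * ((G t \<bullet> G' t) / n t) \<le> k (n t) * (\<gamma> * g * ell (g + n t))"
        using k_pos[of "n t"] by (intro mult_left_mono) auto
      also have "\<dots> = \<gamma> * g"
        using n_pos[of t] g pos[of "g + n t"] by (simp add: k_def)
      finally show "\<exists>y. ((\<lambda>t. Q (n t) - \<gamma> * g * t) has_real_derivative y) (at t) \<and> y \<le> 0"
        using D by (intro exI[of _ "k (n t) * ((G t \<bullet> G' t) / n t) - \<gamma> * g"]) auto
    qed
    then show ?thesis by (simp add: n_def G0)
  qed
  have "Q (sqrt (G \<tau> \<bullet> G \<tau> + 0)) \<le> Q (sqrt 0) + \<gamma> * g * \<tau>"
  proof (rule tendsto_le)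
    show "((\<lambda>\<delta>. Q (sqrt \<delta>) + \<gamma> * g * \<tau>) \<longlongrightarrow> Q (sqrt 0) + \<gamma> * g * \<tau>) (at_right 0)"
      by (intro tendsto_intros isCont_tendsto_compose[OF Q_isCont])
    show "((\<lambda>\<delta>. Q (sqrt (G \<tau> \<bullet> G \<tau> + \<delta>))) \<longlongrightarrow> Q (sqrt (G \<tau> \<bullet> G \<tau> + 0))) (at_right 0)"
      by (intro tendsto_intros isCont_tendsto_compose[OF Q_isCont])
    show "\<forall>\<^sub>F \<delta> in at_right 0. Q (sqrt (G \<tau> \<bullet> G \<tau> + \<delta>)) \<le> Q (sqrt \<delta>) + \<gamma> * g * \<tau>"
      unfolding eventually_at_right_field using Q_smoothed by (intro exI[of _ 1]) auto
  qed simp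
  then have Q_le: "Q (norm (G \<tau>)) - Q 0 \<le> \<gamma> * g * \<tau>"
    by (simp add: norm_eq_sqrt_inner)
  also have "\<dots> \<le> Q g - Q 0"
    unfolding Q_g using \<gamma>_pos g \<tau> by (simp add: mult_left_le)
  \<comment> \<open>The concavity bound applies only up to \<open>g\<close>, so \<open>norm (G \<tau>) \<le> g\<close> is needed
    before the factor \<open>\<tau>\<close> can be gained.\<close>
  finally have "norm (G \<tau>) \<le> g"
    using Q_strict[of g "norm (G \<tau>)"] by linarith
  then have "norm (G \<tau>) * \<gamma> \<le> \<gamma> * g * \<tau>"
    using Q_concave[of "norm (G \<tau>)"] Q_le by simp
  then show ?thesis
    using \<gamma>_pos by (simp add: mult.commute mult.left_commute)
qed

section \<open>Derivatives of extended real functions\<close>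

text \<open>
  The definite description in \<open>gradient\<close> denotes because every linear functional on a Euclidean
  space is the inner product with a unique vector, namely the adjoint applied to \<open>1\<close>.
\<close>

lemma gradient_works:
  fixes f :: "real ^ 'n \<Rightarrow> ereal"
  assumes "(\<lambda>y. real_of_ereal (f y)) differentiable (at x)"
  shows "((\<lambda>y. real_of_ereal (f y)) has_derivative (\<lambda>h. h \<bullet> gradient f x)) (at x)"
proof -
  let ?F = "\<lambda>y. real_of_ereal (f y)"
  obtain F' where F': "(?F has_derivative F') (at x)"
    using assms by (auto simp: differentiable_def)
  have "linear F'"
    using F' has_derivative_linear by blast
  then have "F' = (\<lambda>h. h \<bullet> adjoint F' 1)"
    by (auto simp: adjoint_works)
  then have ex: "GDERIV ?F x :> adjoint F' 1"
    using F' by (simp add: gderiv_def)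
  have "D = adjoint F' 1" if "GDERIV ?F x :> D" for D
  proof -
    have "(\<lambda>h. h \<bullet> D) = (\<lambda>h. h \<bullet> adjoint F' 1)"
      using that ex has_derivative_unique unfolding gderiv_def by blast
    then show ?thesis
      by (metis vector_eq_ldot)
  qed
  with ex have "GDERIV ?F x :> gradient f x"
    unfolding gradient_def by (rule theI)
  then show ?thesis by (simp add: gderiv_def)
qed

lemma hessian_works:
  fixes f :: "real ^ 'n \<Rightarrow> ereal"
  assumes "gradient f differentiable (at x)"
  shows "(gradient f has_derivative (\<lambda>h. hessian f x *v h)) (at x)"
  using assms unfolding hessian_def by (simp add: jacobian_works)

lemma norm_matrix_vector_le_spectral:
  "norm (A *v v) \<le> spectral_norm A * norm v"
  unfolding spectral_norm_def by (rule onorm) (rule matrix_vector_mul_bounded_linear)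

section \<open>Descent along a single gradient step\<close>

text \<open>
  Stated for partial steps, as the bound for \<open>\<tau> < 1\<close> is what keeps the full step inside the domain.
  The slope of \<open>f\<close> along the step is \<open>-\<gamma> (g\<^sup>2 + \<nabla>f(x) \<bullet> G t)\<close>, and \<open>growth_comparison\<close> bounds
  the perturbation \<open>G t\<close> of the gradient by \<open>t g\<close>; \<open>\<tau> - \<tau>\<^sup>2/2\<close> is the integral of \<open>1 - t\<close>.
\<close>

lemma descent_within_domain:
  fixes f :: "real ^ 'n \<Rightarrow> ereal"
  assumes cont: "continuous_on {0..} ell"
    and pos: "\<And>s. 0 \<le> s \<Longrightarrow> 0 < ell s"
    and mono: "\<And>s t. 0 \<le> s \<Longrightarrow> s \<le> t \<Longrightarrow> ell s \<le> ell t"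
    and smooth: "ell_smooth ell f"
    and \<gamma>: "\<gamma> = integral {0..1} (\<lambda>v. 1 / ell (norm (gradient f x) + norm (gradient f x) * v))"
    and \<gamma>_pos: "0 < \<gamma>"
    and \<tau>: "0 \<le> \<tau>" "\<tau> \<le> 1"
    and dom: "\<And>t. 0 \<le> t \<Longrightarrow> t \<le> \<tau> \<Longrightarrow> x - (t * \<gamma>) *\<^sub>R gradient f x \<in> effective_domain f"
  shows "real_of_ereal (f (x - (\<tau> * \<gamma>) *\<^sub>R gradient f x))
    \<le> real_of_ereal (f x) - \<gamma> * (norm (gradient f x))\<^sup>2 * (\<tau> - \<tau>\<^sup>2 / 2)"
proof -
  define g where "g = norm (gradient f x)"
  define p where "p t = x - (t * \<gamma>) *\<^sub>R gradient f x" for t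
  define G where "G t = gradient f (p t) - gradient f x" for t
  have p': "(p has_vector_derivative - (\<gamma> *\<^sub>R gradient f x)) (at t)" for t
    unfolding p_def by (auto intro!: derivative_eq_intros)
  have p_dom: "p t \<in> effective_domain f" if "0 \<le> t" "t \<le> \<tau>" for t
    using dom that by (simp add: p_def)
  have G': "(G has_vector_derivative hessian f (p t) *v - (\<gamma> *\<^sub>R gradient f x)) (at t)"
    if "0 \<le> t" "t \<le> \<tau>" for t
  proof -
    have "gradient f differentiable (at (p t))"
      using smooth p_dom[OF that] by (auto simp: ell_smooth_def twice_differentiable_on_domain_def)
    from vector_derivative_diff_chain_within[OF p' has_derivative_at_withinI[OF hessian_works[OF this]]]
    have "((\<lambda>t. gradient f (p t)) has_vector_derivative
        hessian f (p t) *v - (\<gamma> *\<^sub>R gradient f x)) (at t)"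
      by (simp add: o_def)
    then show ?thesis
      unfolding G_def by (auto intro!: derivative_eq_intros)
  qed
  have G_growth: "norm (hessian f (p t) *v - (\<gamma> *\<^sub>R gradient f x)) \<le> \<gamma> * g * ell (g + norm (G t))"
    if "0 \<le> t" "t \<le> \<tau>" for t
  proof -
    have "norm (gradient f (p t)) \<le> g + norm (G t)"
      unfolding g_def G_def using norm_triangle_sub by blast
    then have "ell (norm (gradient f (p t))) \<le> ell (g + norm (G t))"
      by (intro mono) auto
    moreover have "spectral_norm (hessian f (p t)) \<le> ell (norm (gradient f (p t)))"
      using smooth p_dom[OF that] by (auto simp: ell_smooth_def)
    ultimately have "spectral_norm (hessian f (p t)) \<le> ell (g + norm (G t))" by linarith
    then have "spectral_norm (hessian f (p t)) * norm (- (\<gamma> *\<^sub>R gradient f x))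
        \<le> ell (g + norm (G t)) * norm (- (\<gamma> *\<^sub>R gradient f x))"
      by (rule mult_right_mono) simp
    also have "\<dots> = \<gamma> * g * ell (g + norm (G t))"
      using \<gamma>_pos by (simp add: g_def mult_ac)
    finally show ?thesis
      using norm_matrix_vector_le_spectral order_trans by blast
  qed
  have G_bound: "norm (G t) \<le> t * g" if t: "0 \<le> t" "t \<le> \<tau>" for t
  proof (rule growth_comparison[OF cont pos mono])
    show "\<gamma> = integral {0..1} (\<lambda>v. 1 / ell (g + g * v))"
      unfolding g_def by (rule \<gamma>)
    show "G 0 = 0" by (simp add: G_def p_def)
    fix s assume "s \<in> {0..t}"
    then have s: "0 \<le> s" "s \<le> \<tau>" using t by auto
    show "(G has_vector_derivative hessian f (p s) *v - (\<gamma> *\<^sub>R gradient f x)) (at s)"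
      by (rule G'[OF s])
    show "norm (hessian f (p s) *v - (\<gamma> *\<^sub>R gradient f x)) \<le> \<gamma> * g * ell (g + norm (G s))"
      by (rule G_growth[OF s])
  qed (use t \<tau> \<gamma>_pos in \<open>auto simp: g_def\<close>)
  let ?F = "\<lambda>t. real_of_ereal (f (p t)) + \<gamma> * g\<^sup>2 * (t - t\<^sup>2 / 2)"
  have "?F \<tau> \<le> ?F 0"
  proof (rule DERIV_nonpos_imp_nonincreasing[OF \<tau>(1)])
    fix t assume t: "0 \<le> t" "t \<le> \<tau>"
    have "(\<lambda>y. real_of_ereal (f y)) differentiable (at (p t))"
      using smooth p_dom[OF t] by (auto simp: ell_smooth_def twice_differentiable_on_domain_def)
    from vector_derivative_diff_chain_within[OF p' has_derivative_at_withinI[OF gradient_works[OF this]]]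
    have "((\<lambda>t. real_of_ereal (f (p t))) has_real_derivative
        - (\<gamma> *\<^sub>R gradient f x) \<bullet> gradient f (p t)) (at t)"
      by (simp add: o_def has_real_derivative_iff_has_vector_derivative)
    then have D: "(?F has_real_derivative
        - (\<gamma> *\<^sub>R gradient f x) \<bullet> gradient f (p t) + \<gamma> * g\<^sup>2 * (1 - t)) (at t)"
      by (auto intro!: derivative_eq_intros)
    have "- (gradient f x \<bullet> G t) \<le> g * norm (G t)"
      unfolding g_def using norm_cauchy_schwarz[of "- gradient f x" "G t"] by simp
    also have "\<dots> \<le> g * (t * g)"
      using G_bound[OF t] by (intro mult_left_mono) (auto simp: g_def)
    finally have "\<gamma> * (- (gradient f x \<bullet> G t)) \<le> \<gamma> * (g * (t * g))"
      using \<gamma>_pos by (intro mult_left_mono) auto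
    moreover have "gradient f x \<bullet> gradient f (p t) = g\<^sup>2 + gradient f x \<bullet> G t"
      by (simp add: G_def g_def inner_diff_right power2_norm_eq_inner)
    ultimately have "- (\<gamma> *\<^sub>R gradient f x) \<bullet> gradient f (p t) + \<gamma> * g\<^sup>2 * (1 - t) \<le> 0"
      by (simp add: algebra_simps power2_eq_square)
    with D show "\<exists>y. (?F has_real_derivative y) (at t) \<and> y \<le> 0" by blast
  qed
  then show ?thesis by (simp add: p_def g_def)
qed

text \<open>
  The parameters that keep the step in the domain form a subset of \<open>[0, 1]\<close> that is open, since the
  domain is, and closed: \<open>f\<close> is at most \<open>f x\<close> there by descent, and this passes to limits by continuity
  on the closure of the domain, so a limit point has a finite value.  Convexity serves to
  place the whole partial step in the domain once its endpoint is.
\<close>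

lemma gradient_step_in_domain:
  fixes f :: "real ^ 'n \<Rightarrow> ereal"
  assumes cont: "continuous_on {0..} ell"
    and pos: "\<And>s. 0 \<le> s \<Longrightarrow> 0 < ell s"
    and mono: "\<And>s t. 0 \<le> s \<Longrightarrow> s \<le> t \<Longrightarrow> ell s \<le> ell t"
    and smooth: "ell_smooth ell f"
    and \<gamma>: "\<gamma> = integral {0..1} (\<lambda>v. 1 / ell (norm (gradient f x) + norm (gradient f x) * v))"
    and \<gamma>_pos: "0 < \<gamma>"
    and proper: "\<And>y. f y \<noteq> -\<infinity>"
    and op: "open (effective_domain f)" and conv: "convex (effective_domain f)"
    and x: "x \<in> effective_domain f"
    and t: "t \<in> {0..1}"
  shows "x - (t * \<gamma>) *\<^sub>R gradient f x \<in> effective_domain f"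
proof -
  define p where "p t = x - (t * \<gamma>) *\<^sub>R gradient f x" for t
  define S where "S = {t\<in>{0..1}. p t \<in> effective_domain f}"
  have p_cont: "continuous_on A p" for A
    unfolding p_def by (intro continuous_intros)
  have fin: "f y = ereal (real_of_ereal (f y))" if "y \<in> effective_domain f" for y
    using that proper[of y] by (cases "f y") (auto simp: effective_domain_def)
  have segment: "p s \<in> effective_domain f" if "t \<in> S" "0 \<le> s" "s \<le> t" for s t
  proof (cases "t = 0")
    case True
    then show ?thesis using that x by (simp add: p_def)
  next
    case False
    with that have "(1 - s / t) *\<^sub>R x + (s / t) *\<^sub>R p t \<in> effective_domain f"
      using x by (intro convexD[OF conv]) (auto simp: S_def)
    also have "(1 - s / t) *\<^sub>R x + (s / t) *\<^sub>R p t = p s"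
      using False by (simp add: p_def algebra_simps)
    finally show ?thesis .
  qed
  have le: "f (p t) \<le> f x" if "t \<in> S" for t
  proof -
    have t: "0 \<le> t" "t \<le> 1" using that by (auto simp: S_def)
    have "real_of_ereal (f (p t)) \<le>
        real_of_ereal (f x) - \<gamma> * (norm (gradient f x))\<^sup>2 * (t - t\<^sup>2 / 2)"
      unfolding p_def
      by (rule descent_within_domain[OF cont pos mono smooth \<gamma> \<gamma>_pos t])
         (use segment[OF that] in \<open>auto simp: p_def\<close>)
    moreover have "t * t \<le> t * 1"
      using t by (intro mult_left_mono) auto
    then have "0 \<le> t - t\<^sup>2 / 2"
      using t by (simp add: power2_eq_square)
    then have "0 \<le> \<gamma> * (norm (gradient f x))\<^sup>2 * (t - t\<^sup>2 / 2)"
      using \<gamma>_pos by simp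
    ultimately have "real_of_ereal (f (p t)) \<le> real_of_ereal (f x)" by linarith
    moreover have "p t \<in> effective_domain f" using that by (simp add: S_def)
    ultimately show ?thesis
      using fin[of "p t"] fin[OF x] by (metis ereal_less_eq(3))
  qed
  have "openin (top_of_set {0..1}) S"
    using continuous_openin_preimage_gen[OF p_cont op, of "{0..1}"]
    by (simp add: S_def vimage_def Int_def)
  moreover have "closedin (top_of_set {0..1}) S"
  proof -
    let ?C = "{t\<in>{0..1}. p t \<in> closure (effective_domain f)}"
    have "closed ?C"
      using continuous_closed_preimage[OF p_cont closed_atLeastAtMost closed_closure]
      by (simp add: vimage_def Int_def)
    moreover have "continuous_on ?C (\<lambda>t. f (p t))"
      using smooth by (intro continuous_on_compose2[OF _ p_cont, of "closure (effective_domain f)" f])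
        (auto simp: ell_smooth_def)
    ultimately have "closed (?C \<inter> (\<lambda>t. f (p t)) -` {..f x})"
      by (intro continuous_closed_preimage) auto
    moreover have "?C \<inter> (\<lambda>t. f (p t)) -` {..f x} = S"
    proof (intro equalityI subsetI)
      fix t assume "t \<in> S"
      then show "t \<in> ?C \<inter> (\<lambda>t. f (p t)) -` {..f x}"
        using le closure_subset by (auto simp: S_def)
    next
      fix t assume "t \<in> ?C \<inter> (\<lambda>t. f (p t)) -` {..f x}"
      then show "t \<in> S"
        using x by (auto simp: S_def effective_domain_def)
    qed
    ultimately have "closed S" by simp
    then show ?thesis
      by (rule closed_subset[rotated]) (auto simp: S_def)
  qed
  ultimately have "S = {} \<or> S = {0..1}"
    using connected_clopen[of "{0..1::real}"] by auto
  moreover have "0 \<in> S" using x by (simp add: S_def p_def)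
  ultimately have "t \<in> S" using t by auto
  then show ?thesis by (simp add: S_def p_def)
qed

section \<open>The iteration count\<close>

lemma step_size_lower_bound:
  fixes ell :: "real \<Rightarrow> real"
  assumes cont: "continuous_on {0..} ell"
    and pos: "\<And>s. 0 \<le> s \<Longrightarrow> 0 < ell s"
    and mono: "\<And>s t. 0 \<le> s \<Longrightarrow> s \<le> t \<Longrightarrow> ell s \<le> ell t"
    and g: "0 \<le> g"
  shows "1 / ell (2 * g) \<le> integral {0..1} (\<lambda>v. 1 / ell (g + g * v))"
proof -
  have "integral {0..1::real} (\<lambda>v. 1 / ell (2 * g)) \<le> integral {0..1} (\<lambda>v. 1 / ell (g + g * v))"
  proof (rule integral_le)
    have "continuous_on {0..1} (\<lambda>v. ell (g + g * v))"
      by (rule continuous_on_compose2[OF cont]) (use g in \<open>auto intro!: continuous_intros\<close>)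
    moreover have "ell (g + g * v) \<noteq> 0" if "v \<in> {0..1}" for v
      using pos[of "g + g * v"] g that by auto
    ultimately show "(\<lambda>v. 1 / ell (g + g * v)) integrable_on {0..1}"
      by (intro integrable_continuous_real continuous_intros) auto
    fix v :: real assume v: "v \<in> {0..1}"
    then have "g * v \<le> g"
      using g by (auto intro: mult_left_le)
    then have "ell (g + g * v) \<le> ell (2 * g)"
      using v g by (intro mono) auto
    then show "1 / ell (2 * g) \<le> 1 / ell (g + g * v)"
      using v g pos by (intro divide_left_mono mult_pos_pos) auto
  qed (rule integrable_on_const, simp)
  then show ?thesis by simp
qed

theorem mainTheorem7:
  fixes f :: "real ^ 'n \<Rightarrow> ereal"
    and L0 L1 M fstar \<Delta> :: real
    and ell :: "real \<Rightarrow> real"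
    and x0 :: "real ^ 'n"
    and x :: "nat \<Rightarrow> real ^ 'n"
    and \<gamma> :: "nat \<Rightarrow> real"
  assumes "L0 > 0" and "L1 \<ge> 0" and "M \<ge> 0"
    and "ell = (\<lambda>s. L0 + L1 * s\<^sup>2 * exp s)"
    and "\<And>y. f y \<noteq> -\<infinity>"
    and "open (effective_domain f)" and "convex (effective_domain f)"
    and "ell_smooth ell f"
    and "\<And>y. y \<in> effective_domain f \<Longrightarrow> f y \<ge> ereal fstar"
    and "\<And>y. y \<in> effective_domain f \<Longrightarrow> norm (gradient f y) \<le> M"
    and "x0 \<in> effective_domain f"
    and "\<Delta> = real_of_ereal (f x0) - fstar"
    and "x 0 = x0"
    and "\<And>k. x (Suc k) = x k - \<gamma> k *\<^sub>R gradient f (x k)"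
    and "\<And>k. \<gamma> k = integral {0..1}
          (\<lambda>v. 1 / ell (norm (gradient f (x k)) + norm (gradient f (x k)) * v))"
  shows "\<forall>\<epsilon>>0. \<forall>T::nat. T \<ge> 1 \<longrightarrow>
           real T \<ge> max (8 * L0 * \<Delta> / \<epsilon>) (32 * L1 * \<Delta> * exp (2 * M)) \<longrightarrow>
           (MIN k\<in>{0..T - 1}. (norm (gradient f (x k)))\<^sup>2) \<le> \<epsilon>"
proof (intro allI impI)
  fix \<epsilon> :: real and T :: nat
  assume \<epsilon>: "0 < \<epsilon>" and T: "1 \<le> T"
    and T_ge: "max (8 * L0 * \<Delta> / \<epsilon>) (32 * L1 * \<Delta> * exp (2 * M)) \<le> real T"
  note [simp] = assms(13)
  have ell: "ell s = L0 + L1 * s\<^sup>2 * exp s" for s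
    by (simp add: assms(4))
  have cont: "continuous_on {0..} ell"
    unfolding assms(4) by (intro continuous_intros)
  have pos: "0 < ell s" for s
    using assms(1,2) by (simp add: ell add_pos_nonneg)
  have mono: "ell s \<le> ell t" if "0 \<le> s" "s \<le> t" for s t
    using that assms(2) unfolding ell
    by (intro add_left_mono mult_mono mult_left_mono power_mono) auto
  define g where "g k = norm (gradient f (x k))" for k
  have \<gamma>_ge: "1 / ell (2 * g k) \<le> \<gamma> k" for k
    unfolding assms(15) g_def by (rule step_size_lower_bound[OF cont pos mono]) auto
  have \<gamma>_pos: "0 < \<gamma> k" for k
    using \<gamma>_ge[of k] pos[of "2 * g k"] by (smt (verit) divide_pos_pos)
  have stay: "x k - (t * \<gamma> k) *\<^sub>R gradient f (x k) \<in> effective_domain f"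
    if "x k \<in> effective_domain f" "t \<in> {0..1}" for k t
    by (rule gradient_step_in_domain[OF cont pos mono assms(8) assms(15) \<gamma>_pos assms(5-7) that])
  have dom: "x k \<in> effective_domain f" for k
  proof (induction k)
    case 0
    then show ?case using assms(11) by simp
  next
    case (Suc k)
    then show ?case using stay[of k 1] by (simp add: assms(14))
  qed
  define F where "F k = real_of_ereal (f (x k))" for k
  have descent: "F (Suc k) \<le> F k - \<gamma> k * (g k)\<^sup>2 / 2" for k
    using descent_within_domain[OF cont pos mono assms(8) assms(15) \<gamma>_pos, of 1 k] stay[OF dom]
    by (simp add: F_def g_def assms(14))
  show "(MIN k\<in>{0..T - 1}. (norm (gradient f (x k)))\<^sup>2) \<le> \<epsilon>"
  proof (rule ccontr)
    assume neg: "\<not> ?thesis"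
    have g_big: "\<epsilon> < (g k)\<^sup>2" if "k < T" for k
    proof -
      have "(MIN k\<in>{0..T - 1}. (norm (gradient f (x k)))\<^sup>2) \<le> (norm (gradient f (x k)))\<^sup>2"
        using that by (intro Min_le) auto
      then show ?thesis using neg by (simp add: g_def)
    qed
    \<comment> \<open>\<open>C\<close> is \<open>\<ell>(2 s)\<close> with \<open>s\<^sup>2\<close> replaced by \<open>\<epsilon>\<close> and the exponent by its upper bound \<open>2 M\<close>.\<close>
    define C where "C = L0 + 4 * L1 * \<epsilon> * exp (2 * M)"
    have C_pos: "0 < C"
      unfolding C_def using assms(1,2) \<epsilon> by (simp add: add_pos_nonneg)
    have decrease: "F (Suc k) < F k - \<epsilon> / (4 * C)" if "k < T" for k
    proof -
      have "g k \<le> M"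
        unfolding g_def by (rule assms(10)[OF dom])
      then have "L1 * (2 * g k)\<^sup>2 * exp (2 * g k) \<le> L1 * (2 * g k)\<^sup>2 * exp (2 * M)"
        using assms(2) by (intro mult_left_mono) auto
      then have "ell (2 * g k) \<le> L0 + 4 * L1 * exp (2 * M) * (g k)\<^sup>2"
        by (simp add: ell power_mult_distrib mult_ac)
      then have "\<epsilon> * ell (2 * g k) \<le> \<epsilon> * L0 + \<epsilon> * (4 * L1 * exp (2 * M) * (g k)\<^sup>2)"
        using \<epsilon> mult_left_mono[of _ _ \<epsilon>] by (fastforce simp: distrib_left)
      also have "\<dots> \<le> (g k)\<^sup>2 * C"
        unfolding C_def using g_big[OF that] assms(1) mult_right_mono[of \<epsilon> "(g k)\<^sup>2" L0]
        by (simp add: algebra_simps)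
      finally have "\<epsilon> / C \<le> (g k)\<^sup>2 * (1 / ell (2 * g k))"
        using C_pos pos[of "2 * g k"] by (simp add: field_simps)
      also have "\<dots> \<le> (g k)\<^sup>2 * \<gamma> k"
        by (intro mult_left_mono \<gamma>_ge) simp
      finally have "\<epsilon> / C / 2 \<le> \<gamma> k * (g k)\<^sup>2 / 2" by (simp add: mult.commute)
      moreover have "\<epsilon> / (4 * C) < \<epsilon> / C / 2"
        using \<epsilon> C_pos by (simp add: field_simps)
      ultimately show ?thesis using descent[of k] by linarith
    qed
    define d where "d = \<epsilon> / (4 * C)"
    have total: "n \<le> T \<Longrightarrow> F n \<le> F 0 - real n * d" for n
    proof (induction n)
      case (Suc n)
      moreover have "F (Suc n) < F n - d"
        unfolding d_def using Suc.prems by (intro decrease) simp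
      ultimately show ?case by (simp add: distrib_right)
    qed simp
    \<comment> \<open>\<open>T\<close> may attain its lower bound, so the contradiction needs a strict inequality; treating
      the last step separately supplies it, while \<open>total\<close> is an equality for \<open>n = 0\<close>.\<close>
    obtain m where m: "T = Suc m" using T by (cases T) auto
    have "F T < F m - d"
      unfolding d_def m by (intro decrease) (simp add: m)
    also have "F m - d \<le> F 0 - real T * d"
      using total[of m] by (simp add: m distrib_right)
    finally have "F T < F 0 - real T * (\<epsilon> / (4 * C))"
      by (simp only: d_def)
    moreover have "fstar \<le> F T"
      using assms(9)[OF dom[of T]] dom[of T] assms(5)[of "x T"]
      by (cases "f (x T)") (auto simp: F_def effective_domain_def)
    ultimately have "real T * (\<epsilon> / (4 * C)) < \<Delta>"
      using assms(12) by (simp add: F_def)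
    then have "real T * \<epsilon> < 4 * C * \<Delta>"
      using C_pos by (simp add: field_simps)
    moreover have "8 * L0 * \<Delta> \<le> real T * \<epsilon>"
      using T_ge \<epsilon> by (simp add: field_simps)
    moreover have "32 * L1 * \<Delta> * exp (2 * M) * \<epsilon> \<le> real T * \<epsilon>"
      using T_ge \<epsilon> by (intro mult_right_mono) auto
    ultimately show False
      unfolding C_def by (simp add: algebra_simps)
  qed
qed

end
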